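(* Let $a,b\in\mathbb{R}$ with $b-a$ a positive integer, let $\alpha\in(0,1/2)$, and let $p,q,r$ be real-valued functions on $\mathbb{N}_{a,b}$ with $p(t)>0$ and $r(t)>0$ for all $t\in\mathbb{N}_{a,b}$. Consider the nabla discrete fractional Sturm--Liouville operator $$L_2x(t)={}^{ABR}_{a}\nabla^\alpha\big(p(t)\,{}^{ABR}\nabla^\alpha_b x(t)\big)+q(t)x(t),\qquad t\in\mathbb{N}_{a+1,b-1}.$$ Then $L_2$ is self-adjoint with respect to the inner product $\langle u,v\rangle=\sum_{t=a+1}^{b-1}\overline{u(t)}\,v(t)$; that is, $\langle L_2u,v\rangle=\langle u,L_2v\rangle$ for all functions $u,v:\mathbb{N}_{a,b}\to\mathbb{C}$.
   Context: Notation: $\mathbb{N}_{c,d}=\{c,c+1,\dots,d\}$ (empty if $d<c$); $\rho(t)=t-1$; $\nabla f(t)=f(t)-f(t-1)$, $\Delta f(t)=f(t+1)-f(t)$; empty sums are $0$. The rising function is $t^{\overline{\gamma}}=\Gamma(t+\gamma)/\Gamma(t)$. For $|\lambda|<1$ the nabla discrete Mittag-Leffler function is $E_{\overline{\alpha}}(\lambda,z)=\sum_{k=0}^\infty\lambda^k\frac{z^{\overline{k\alpha}}}{\Gamma(\alpha k+1)}$ (here used only for positive integers $z$). $B(\alpha)>0$ is a normalization constant. The left and right nabla discrete ABR fractional differences of order $\alpha\in(0,1/2)$ are $${}^{ABR}_{a}\nabla^\alpha f(t)=\frac{B(\alpha)}{1-\alpha}\nabla_t\sum_{s=a+1}^t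 f(s)E_{\overline{\alpha}}\Big(\tfrac{-\alpha}{1-\alpha},t-\rho(s)\Big),\quad t\in\{a+1,a+2,\dots\},$$ $${}^{ABR}\nabla_b^\alpha f(t)=-\frac{B(\alpha)}{1-\alpha}\Delta_t\sum_{s=t}^{b-1} f(s)E_{\overline{\alpha}}\Big(\tfrac{-\alpha}{1-\alpha},s-\rho(t)\Big),\quad t\in\{\dots,b-2,b-1\}.$$ *)

theory Defs
  imports "HOL-Analysis.Analysis"
begin

text \<open>
  The time scale points are real numbers. A function on \<open>grid a b\<close> is rendered as a total
  function on the reals; everything below that is evaluated at points of
  \<open>grid (a + 1) (b - 1)\<close> only depends on the values at points of \<open>grid a b\<close>.
\<close>

definition grid :: "real \<Rightarrow> real \<Rightarrow> real set" where
  "grid c d = {t. t \<le> d \<and> (\<exists>k::nat. t = c + real k)}"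

definition nabla :: "(real \<Rightarrow> complex) \<Rightarrow> real \<Rightarrow> complex" where
  "nabla f t = f t - f (t - 1)"

definition forward_diff :: "(real \<Rightarrow> complex) \<Rightarrow> real \<Rightarrow> complex" where
  "forward_diff f t = f (t + 1) - f t"

definition back_jump :: "real \<Rightarrow> real" where
  "back_jump t = t - 1"

definition rising :: "real \<Rightarrow> real \<Rightarrow> real" where
  "rising t \<gamma> = Gamma (t + \<gamma>) / Gamma t"

text \<open>
  Only used for \<open>\<bar>\<mu>\<bar> < 1\<close> and positive integers \<open>z\<close>, where the series converges
  (for \<open>\<alpha> > 0\<close>) and no Gamma factor is evaluated at a pole.
\<close>

definition nabla_ML :: "real \<Rightarrow> real \<Rightarrow> real \<Rightarrow> real" where
  "nabla_ML \<alpha> \<mu> z = (\<Sum>k. \<mu> ^ k * rising z (real k * \<alpha>) / Gamma (\<alpha> * real k + 1))"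

text \<open>
  In both differences the outer difference operator acts on the whole sum, so \<open>t\<close> is shifted
  both in the summation limit and in the kernel.
\<close>

definition ABR_left ::
    "(real \<Rightarrow> real) \<Rightarrow> real \<Rightarrow> real \<Rightarrow> (real \<Rightarrow> complex) \<Rightarrow> real \<Rightarrow> complex" where
  "ABR_left B a \<alpha> f t =
     of_real (B \<alpha> / (1 - \<alpha>)) *
     nabla (\<lambda>\<tau>. \<Sum>s\<in>grid (a + 1) \<tau>.
              f s * of_real (nabla_ML \<alpha> (- \<alpha> / (1 - \<alpha>)) (\<tau> - back_jump s))) t"

definition ABR_right ::
    "(real \<Rightarrow> real) \<Rightarrow> real \<Rightarrow> real \<Rightarrow> (real \<Rightarrow> complex) \<Rightarrow> real \<Rightarrow> complex" where
  "ABR_right B b \<alpha> f t =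
     - of_real (B \<alpha> / (1 - \<alpha>)) *
     forward_diff (\<lambda>\<tau>. \<Sum>s\<in>grid \<tau> (b - 1).
              f s * of_real (nabla_ML \<alpha> (- \<alpha> / (1 - \<alpha>)) (s - back_jump \<tau>))) t"

definition SL_op ::
    "(real \<Rightarrow> real) \<Rightarrow> real \<Rightarrow> real \<Rightarrow> real \<Rightarrow> (real \<Rightarrow> real) \<Rightarrow> (real \<Rightarrow> real) \<Rightarrow>
     (real \<Rightarrow> complex) \<Rightarrow> real \<Rightarrow> complex" where
  "SL_op B a b \<alpha> p q x t =
     ABR_left B a \<alpha> (\<lambda>s. of_real (p s) * ABR_right B b \<alpha> x s) t + of_real (q t) * x t"

definition grid_inner :: "real \<Rightarrow> real \<Rightarrow> (real \<Rightarrow> complex) \<Rightarrow> (real \<Rightarrow> complex) \<Rightarrow> complex" where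
  "grid_inner a b u v = (\<Sum>t\<in>grid (a + 1) (b - 1). cnj (u t) * v t)"

end

theory Submission
  imports Defs
begin

text \<open>
  On \<open>grid (a + 1) (b - 1)\<close> both fractional differences are finite sums with real
  coefficients, and their coefficient matrices are transposes of each other. Hence they are
  adjoint, and writing \<open>R\<close> for the right difference,
  \<open>\<langle>L\<^sub>2 u, v\<rangle> = \<langle>p R u, R v\<rangle> + \<langle>q u, v\<rangle>\<close>, which is symmetric because
  \<open>p\<close> and \<open>q\<close> are real.
\<close>

lemma finite_grid: "finite (grid c d)"
proof (rule finite_subset)
  show "grid c d \<subseteq> (\<lambda>k::nat. c + real k) ` {..nat \<lfloor>d - c\<rfloor>}"
    by (auto simp: grid_def le_nat_floor)
qed auto

lemma grid_initial_segment:
  assumes "\<tau> \<le> d"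
  shows "grid c \<tau> = {s \<in> grid c d. s \<le> \<tau>}"
  using assms by (auto simp: grid_def)

text \<open>A grid is anchored at its left end, so moving that end keeps the same lattice only
  because \<open>t\<close> lies on it. The shifts 0 and 1 serve the two sums in the forward
  difference.\<close>

lemma grid_final_segment:
  assumes "t \<in> grid c d"
  shows "grid (t + real n) d = {s \<in> grid c d. t + real n \<le> s}"
proof (rule set_eqI)
  fix s
  obtain j where j: "t = c + real j"
    using assms by (auto simp: grid_def)
  have "s = c + real (j + n + k)" if "s = t + real n + real k" for k
    using that j by simp
  \<comment> \<open>The truncated subtraction is exact: \<open>t + real n \<le> s\<close> forces
    \<open>j + n \<le> k\<close>.\<close>
  moreover have "s = t + real n + real (k - (j + n))"
    if "s = c + real k" "t + real n \<le> s" for k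
    using that j by (simp add: of_nat_diff)
  ultimately show "s \<in> grid (t + real n) d \<longleftrightarrow> s \<in> {s \<in> grid c d. t + real n \<le> s}"
    unfolding grid_def by (smt (verit) mem_Collect_eq of_nat_0_le_iff)
qed

text \<open>Up to the constant factor, the matrix entry of the left difference: the kernel in the
  sum up to \<open>t\<close> minus the kernel in the sum up to \<open>t - 1\<close>. The zero cases
  allow one summation range for all \<open>t\<close>.\<close>

definition ABR_coeff :: "real \<Rightarrow> real \<Rightarrow> real \<Rightarrow> real" where
  "ABR_coeff \<alpha> s t =
     (if s \<le> t then nabla_ML \<alpha> (- \<alpha> / (1 - \<alpha>)) (t - s + 1) else 0) -
     (if s + 1 \<le> t then nabla_ML \<alpha> (- \<alpha> / (1 - \<alpha>)) (t - s) else 0)"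

lemma ABR_left_eq_sum:
  assumes "t \<in> grid (a + 1) d"
  shows "ABR_left B a \<alpha> f t =
    of_real (B \<alpha> / (1 - \<alpha>)) * (\<Sum>s\<in>grid (a + 1) d. f s * of_real (ABR_coeff \<alpha> s t))"
proof -
  \<comment> \<open>At \<open>t = a + 1\<close> the segment up to \<open>t - 1\<close> is empty, so
    no boundary case arises.\<close>
  have "t \<le> d" "t - 1 \<le> d"
    using assms by (auto simp: grid_def)
  note segments = this[THEN grid_initial_segment, of "a + 1"]
  show ?thesis
    unfolding ABR_left_def nabla_def segments sum.inter_filter[OF finite_grid]
      sum_subtractf[symmetric]
    by (intro arg_cong2[where f = "(*)"] sum.cong refl)
       (auto simp: ABR_coeff_def back_jump_def algebra_simps)
qed

lemma ABR_right_eq_sum: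
  assumes "t \<in> grid c (b - 1)"
  shows "ABR_right B b \<alpha> f t =
    of_real (B \<alpha> / (1 - \<alpha>)) * (\<Sum>s\<in>grid c (b - 1). f s * of_real (ABR_coeff \<alpha> t s))"
proof -
  have segments: "grid t (b - 1) = {s \<in> grid c (b - 1). t \<le> s}"
      "grid (t + 1) (b - 1) = {s \<in> grid c (b - 1). t + 1 \<le> s}"
    using grid_final_segment[OF assms, of 0] grid_final_segment[OF assms, of 1] by auto
  \<comment> \<open>The sign of the right difference reverses the order of subtraction, which gives
    exactly the transposed coefficient.\<close>
  have flip: "- x * (y - z) = x * (z - y)" for x y z :: complex
    by (simp add: algebra_simps)
  show ?thesis
    unfolding ABR_right_def forward_diff_def segments sum.inter_filter[OF finite_grid] flip
    unfolding sum_subtractf[symmetric]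
    by (intro arg_cong2[where f = "(*)"] sum.cong refl)
       (auto simp: ABR_coeff_def back_jump_def algebra_simps)
qed

lemma grid_inner_ABR_left:
  "grid_inner a b (ABR_left B a \<alpha> f) g = grid_inner a b f (ABR_right B b \<alpha> g)"
proof -
  let ?G = "grid (a + 1) (b - 1)" and ?c = "complex_of_real (B \<alpha> / (1 - \<alpha>))"
  have "grid_inner a b (ABR_left B a \<alpha> f) g =
      (\<Sum>t\<in>?G. \<Sum>s\<in>?G. ?c * cnj (f s) * of_real (ABR_coeff \<alpha> s t) * g t)"
    unfolding grid_inner_def
    by (intro sum.cong refl)
       (simp add: ABR_left_eq_sum sum_distrib_left sum_distrib_right mult_ac)
  also have "\<dots> = (\<Sum>s\<in>?G. \<Sum>t\<in>?G. ?c * cnj (f s) * of_real (ABR_coeff \<alpha> s t) * g t)"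
    by (rule sum.swap)
  also have "\<dots> = grid_inner a b f (ABR_right B b \<alpha> g)"
    unfolding grid_inner_def
    by (intro sum.cong refl)
       (simp add: ABR_right_eq_sum sum_distrib_left mult_ac)
  finally show ?thesis .
qed

lemma cnj_grid_inner: "cnj (grid_inner a b u v) = grid_inner a b v u"
  by (simp add: grid_inner_def mult.commute)

lemma grid_inner_SL_op:
  "grid_inner a b (SL_op B a b \<alpha> p q u) v =
     grid_inner a b (\<lambda>s. of_real (p s) * ABR_right B b \<alpha> u s) (ABR_right B b \<alpha> v) +
     grid_inner a b (\<lambda>t. of_real (q t) * u t) v"
  \<comment> \<open>Adjointness, read backwards, restores the left difference; only additivity in
    the first slot remains.\<close>
  unfolding grid_inner_ABR_left[symmetric]
  by (simp add: grid_inner_def SL_op_def sum.distrib distrib_right)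

lemma grid_inner_of_real_mult:
  "grid_inner a b (\<lambda>t. of_real (h t) * u t) v = grid_inner a b u (\<lambda>t. of_real (h t) * v t)"
  by (simp add: grid_inner_def mult_ac)

theorem theorem8:
  fixes a b \<alpha> :: real and B p q r :: "real \<Rightarrow> real"
  assumes "b - a \<in> \<nat>" and "b - a > 0"
    and "0 < \<alpha>" and "\<alpha> < 1 / 2"
    and "B \<alpha> > 0"
    and "\<And>t. t \<in> grid a b \<Longrightarrow> p t > 0"
    and "\<And>t. t \<in> grid a b \<Longrightarrow> r t > 0"
  shows "\<forall>u v :: real \<Rightarrow> complex.
    grid_inner a b (SL_op B a b \<alpha> p q u) v = grid_inner a b u (SL_op B a b \<alpha> p q v)"
proof (intro allI)
  fix u v :: "real \<Rightarrow> complex"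
  have "grid_inner a b u (SL_op B a b \<alpha> p q v) = cnj (grid_inner a b (SL_op B a b \<alpha> p q v) u)"
    by (simp add: cnj_grid_inner)
  \<comment> \<open>Both operators now stand in the first slot and can be expanded; the real
    weights, fixed by \<open>cnj\<close>, are then collected in the second slot, where both sides
    agree.\<close>
  also have "\<dots> = grid_inner a b (SL_op B a b \<alpha> p q u) v"
    by (simp add: grid_inner_SL_op cnj_grid_inner grid_inner_of_real_mult)
  finally show "grid_inner a b (SL_op B a b \<alpha> p q u) v =
      grid_inner a b u (SL_op B a b \<alpha> p q v)" ..
qed

end
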